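(* For every integer $n\ge 1$, the complete graph $K_{2n}$ on $2n$ vertices has a Hamiltonian path decomposition consisting of $n$ pairwise edge-disjoint Hamiltonian paths; that is, there are $n$ Hamiltonian paths of $K_{2n}$ such that every edge of $K_{2n}$ belongs to exactly one of them.
   Context: A Hamiltonian path of a graph is a path that contains every vertex of the graph. *)

theory Defs
  imports "Graph_Theory.Kuratowski" "Graph_Theory.Vertex_Walk"
begin

text \<open>
  In \<open>Graph_Theory\<close>, an undirected simple graph is a symmetric loop-free digraph without
  parallel arcs (locale \<open>graph\<close>, which is part of \<^const>\<open>complete_digraph\<close>), so each
  undirected edge is represented by two opposite arcs. The undirected edge itself is
  the unordered pair of their ends.
\<close>

definition undirected_edges :: "('a, 'b) pre_digraph \<Rightarrow> 'a set set" where
  "undirected_edges G = {{u, v} | u v. (u, v) \<in> arcs_ends G}"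

definition path_edges :: "'a vwalk \<Rightarrow> 'a set set" where
  "path_edges p = {{u, v} | u v. (u, v) \<in> set (vwalk_arcs p)}"

definition hamiltonian_path :: "'a vwalk \<Rightarrow> ('a, 'b) pre_digraph \<Rightarrow> bool" where
  "hamiltonian_path p G \<longleftrightarrow> vpath p G \<and> verts G \<subseteq> set p"

text \<open>
  A path and its reversal have the same edges, so a decomposition of a graph with at least
  two vertices contains at most one of the two vertex sequences.
\<close>

definition hamiltonian_path_decomposition ::
    "'a vwalk set \<Rightarrow> ('a, 'b) pre_digraph \<Rightarrow> bool" where
  "hamiltonian_path_decomposition P G \<longleftrightarrow>
     (\<forall>p\<in>P. hamiltonian_path p G) \<and>
     pairwise (\<lambda>p q. disjnt (path_edges p) (path_edges q)) P \<and>
     (\<forall>e\<in>undirected_edges G. \<exists>!p. p \<in> P \<and> e \<in> path_edges p)"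

end

theory Submission
  imports Defs "HOL-Number_Theory.Cong"
begin

text \<open>
  This is the zigzag construction of Lucas and Walecki. Label the vertices by the residues
  modulo \<open>2 * n\<close> and picture them as the corners of a regular polygon. The zigzag
  \<open>0, -1, 1, -2, 2, \<dots>\<close>, which ends at \<open>n\<close>, visits every residue once, and its edges
  are chords in just two neighbouring directions: the ends of successive edges add up
  alternately to \<open>-1\<close> and to \<open>0\<close>. Rotating by \<open>i\<close> turns these two sums into
  \<open>2 * i - 1\<close> and \<open>2 * i\<close>, so as \<open>i\<close> runs through \<open>0, \<dots>, n - 1\<close> the rotated zigzags
  use every sum, hence every direction, in exactly one path.

  Disjointness follows because the sum of its ends modulo \<open>2 * n\<close> tells to which rotation an
  edge belongs (\<open>zigzag_edge_index\<close>). For covering, the rotation \<open>i\<close> that the sum of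
  \<open>u\<close> and \<open>v\<close> dictates visits \<open>u\<close> somewhere, and the neighbour of \<open>u\<close> along it with
  the right sum can only be \<open>v\<close> (\<open>zigzag_covers_edge\<close>).
\<close>

section \<open>Zigzags modulo an even number\<close>

text \<open>
  The vertex at position \<open>j\<close> of the zigzag rotated by \<open>i\<close>. The negative residue
  \<open>-k\<close> at the odd position \<open>2 * k - 1\<close> is written as the natural number \<open>2 * n - k\<close>.
\<close>

definition zigzag :: "nat \<Rightarrow> nat \<Rightarrow> nat \<Rightarrow> nat" where
  "zigzag n i j = (i + (if even j then j div 2 else 2 * n - (j + 1) div 2)) mod (2 * n)"

lemma zigzag_less: "n \<ge> 1 \<Longrightarrow> zigzag n i j < 2 * n"
  by (simp add: zigzag_def)

lemma zigzag_0: "i < n \<Longrightarrow> zigzag n i 0 = i"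
  by (simp add: zigzag_def)

lemma zigzag_last:
  assumes "i < n"
  shows "zigzag n i (2 * n - 1) = i + n"
  using assms by (simp add: zigzag_def)

text \<open>
  Before the rotation, even positions run upwards through the residues \<open>0, \<dots>, n - 1\<close> and odd positions downwards
  through the others, so undoing the rotation shows where \<open>u\<close> is visited.
\<close>

lemma zigzag_surj:
  assumes "i < n" and "u < 2 * n"
  obtains j where "j < 2 * n" and "zigzag n i j = u"
proof -
  define r where "r = (u + 2 * n - i) mod (2 * n)"
  have r: "r < 2 * n" using assms by (simp add: r_def)
  have "(i + r) mod (2 * n) = (i + (u + 2 * n - i)) mod (2 * n)"
    unfolding r_def by (rule mod_add_right_eq)
  also have "\<dots> = u" using assms by simp
  finally have rot: "(i + r) mod (2 * n) = u" .
  show thesis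
  proof (cases "r < n")
    case True
    then show ?thesis using rot that[of "2 * r"] by (simp add: zigzag_def)
  next
    case False
    have "zigzag n i (2 * (2 * n - r) - 1) = (i + r) mod (2 * n)"
      using r by (simp add: zigzag_def)
    with False r rot show ?thesis using that[of "2 * (2 * n - r) - 1"] by simp
  qed
qed

text \<open>
  One is added to the sum of the ends so that the two values belonging to rotation \<open>i\<close> are
  \<open>2 * i\<close> and \<open>2 * i + 1\<close>, without a wrap-around at \<open>i = 0\<close>.
\<close>

lemma zigzag_step:
  assumes "i < n" and "Suc j < 2 * n"
  shows "(zigzag n i j + zigzag n i (Suc j) + 1) mod (2 * n) = (if even j then 2 * i else 2 * i + 1)"
proof -
  let ?z = "\<lambda>j. if even j then j div 2 else 2 * n - (j + 1) div 2"
  have "(zigzag n i j + zigzag n i (Suc j) + 1) mod (2 * n)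
      = ((i + ?z j) + (i + ?z (Suc j)) + 1) mod (2 * n)"
    unfolding zigzag_def by (rule mod_add_cong[OF mod_add_eq refl])
  also have "(i + ?z j) + (i + ?z (Suc j)) + 1 = (if even j then 2 * i else 2 * i + 1) + 2 * n"
  proof (cases "even j")
    case True
    then obtain k where "j = 2 * k" by (rule evenE)
    then show ?thesis using assms by simp
  next
    case False
    then obtain k where "j = 2 * k + 1" by (rule oddE)
    then show ?thesis using assms by simp
  qed
  also have "\<dots> mod (2 * n) = (if even j then 2 * i else 2 * i + 1)"
    using assms by simp
  finally show ?thesis .
qed

corollary zigzag_edge_index:
  assumes "i < n" and "Suc j < 2 * n"
  shows "(zigzag n i j + zigzag n i (Suc j) + 1) mod (2 * n) div 2 = i"
  using zigzag_step[OF assms] by simp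

text \<open>
  At every position of the zigzag the two possible sums lie on different sides. The required
  side is missing only at the two ends of the path, and there the residue with the right sum
  would be \<open>u\<close> itself.
\<close>

lemma zigzag_covers_edge:
  assumes u: "u < 2 * n" and v: "v < 2 * n" and "u \<noteq> v"
    and i: "i = (u + v + 1) mod (2 * n) div 2"
  obtains j where "Suc j < 2 * n" and "{zigzag n i j, zigzag n i (Suc j)} = {u, v}"
proof -
  note found = that
  let ?t = "(u + v + 1) mod (2 * n)"
  have "?t < 2 * n" using u by simp
  then have "i < n" using i by simp
  obtain j where j: "j < 2 * n" "zigzag n i j = u" using zigzag_surj[OF \<open>i < n\<close> u] .
  have v_eqI: "w = v" if "w < 2 * n" and "(u + w + 1) mod (2 * n) = ?t" for w
  proof -
    have "[w + (u + 1) = v + (u + 1)] (mod (2 * n))"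
      using that(2) by (simp add: cong_def add_ac)
    then have "[w = v] (mod (2 * n))" by (simp only: cong_add_rcancel_nat)
    then show ?thesis using that(1) v by (simp add: cong_def)
  qed
  have forward: thesis
    if "Suc j < 2 * n" and "?t = (if even j then 2 * i else 2 * i + 1)"
  proof -
    have "zigzag n i (Suc j) = v"
      using zigzag_step[OF \<open>i < n\<close> that(1)] that j(2) zigzag_less \<open>i < n\<close> by (intro v_eqI) auto
    then show ?thesis using found[of j] that(1) j(2) by simp
  qed
  have backward: thesis
    if "j = Suc k" and "?t = (if even k then 2 * i else 2 * i + 1)" for k
  proof -
    have "zigzag n i k = v"
      using zigzag_step[OF \<open>i < n\<close>, of k] that j zigzag_less \<open>i < n\<close>
      by (intro v_eqI) (auto simp: add_ac)
    then show ?thesis using found[of k] that(1) j by (simp add: insert_commute)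
  qed
  consider "?t = 2 * i" | "?t = 2 * i + 1" using i by linarith
  then show thesis
  proof cases
    case 1
    show ?thesis
    proof (cases "even j")
      case True
      moreover have "Suc j \<noteq> 2 * n"
        using True by presburger
      ultimately show ?thesis using forward 1 j(1) by simp
    next
      case False
      then obtain k where "j = Suc k" "even k" by (cases j) auto
      then show ?thesis using backward 1 by simp
    qed
  next
    case 2
    show ?thesis
    proof (cases "even j")
      case True
      show ?thesis
      proof (cases j)
        case 0
        then have "u = i" using j(2) zigzag_0[OF \<open>i < n\<close>] by simp
        then have "i = v" using 2 \<open>i < n\<close> by (intro v_eqI) auto
        with \<open>u = i\<close> \<open>u \<noteq> v\<close> show ?thesis by simp
      next
        case (Suc k)
        then show ?thesis using True backward 2 by simp
      qed
    next
      case False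
      show ?thesis
      proof (cases "Suc j = 2 * n")
        case True
        then have "j = 2 * n - 1" by simp
        then have "u = i + n" using j(2) zigzag_last[OF \<open>i < n\<close>] by simp
        then have "u + u + 1 = (2 * i + 1) + 2 * n" by simp
        also have "\<dots> mod (2 * n) = ?t" using 2 \<open>i < n\<close> by (simp only: mod_add_self2) simp
        finally have "u = v" using u by (intro v_eqI)
        with \<open>u \<noteq> v\<close> show ?thesis by simp
      next
        case False
        then show ?thesis using \<open>odd j\<close> forward 2 j(1) by simp
      qed
    qed
  qed
qed

section \<open>Hamiltonian paths in the complete graph\<close>

lemma set_vwalk_arcs_map_upt:
  "set (vwalk_arcs (map g [0..<m])) = {(g j, g (Suc j)) | j. Suc j < m}"
proof (induction m)
  case 0
  then show ?case by simp
next
  case (Suc m)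
  show ?case
  proof (cases m)
    case 0
    then show ?thesis by simp
  next
    case (Suc k)
    then have "vwalk_arcs (map g [0..<Suc m]) = vwalk_arcs (map g [0..<m]) @ [(g k, g m)]"
      using vwalk_arcs_append[of "map g [0..<m]" "[g m]"] by simp
    then show ?thesis using Suc.IH \<open>m = Suc k\<close> by (auto simp: less_Suc_eq)
  qed
qed

lemma path_edges_map_upt:
  "path_edges (map g [0..<m]) = {{g j, g (Suc j)} | j. Suc j < m}"
  unfolding path_edges_def set_vwalk_arcs_map_upt by auto

text \<open>
  A listing of the vertices that is as long as their number and misses none of them repeats
  none either.
\<close>

lemma hamiltonian_path_map_upt:
  assumes "complete_digraph m G" and "m \<ge> 1" and "g ` {..<m} = verts G"
  shows "hamiltonian_path (map g [0..<m]) G"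
proof -
  have set: "set (map g [0..<m]) = verts G"
    using assms(3) by (simp add: atLeast0LessThan)
  have "card (verts G) = m" using assms(1) by (simp add: complete_digraph_def)
  with set have distinct: "distinct (map g [0..<m])" by (intro card_distinct) simp
  then have inj: "inj_on g {0..<m}" by (simp add: distinct_map)
  have "set (vwalk_arcs (map g [0..<m])) \<subseteq> arcs_ends G"
  proof -
    have "g j \<noteq> g (Suc j)" if "Suc j < m" for j
      using inj_onD[OF inj, of j "Suc j"] that by auto
    moreover have "g j \<in> verts G" if "j < m" for j
      using assms(3) that by auto
    ultimately show ?thesis
      using assms(1) by (auto simp: set_vwalk_arcs_map_upt complete_digraph_def)
  qed
  with set distinct show ?thesis
    using assms(2) by (auto simp: hamiltonian_path_def vpath_def vwalk_def)
qed

theorem proposition5p1: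
  fixes n :: nat and G :: "('a, 'b) pre_digraph"
  assumes "n \<ge> 1" and "complete_digraph (2 * n) G"
  shows "\<exists>P. card P = n \<and> hamiltonian_path_decomposition P G"
proof -
  have card: "card (verts G) = 2 * n"
    and ends: "arcs_ends G = {(u, v). (u, v) \<in> verts G \<times> verts G \<and> u \<noteq> v}"
    using assms(2) by (auto simp: complete_digraph_def)
  have "finite (verts G)" using card assms(1) by (simp add: card_ge_0_finite)
  then obtain f where "bij_betw f {0..<2 * n} (verts G)"
    using card ex_bij_betw_nat_finite by metis
  then have f: "bij_betw f {..<2 * n} (verts G)" by (simp add: atLeast0LessThan)
  then have inj: "inj_on f {..<2 * n}" and surj: "f ` {..<2 * n} = verts G"
    by (auto simp: bij_betw_def)
  define p where "p i = map (\<lambda>j. f (zigzag n i j)) [0..<2 * n]" for i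
  have edges: "path_edges (p i) = {{f (zigzag n i j), f (zigzag n i (Suc j))} | j. Suc j < 2 * n}"
    for i
    by (simp add: p_def path_edges_map_upt)
  have ham: "hamiltonian_path (p i) G" if "i < n" for i
  proof -
    have "zigzag n i ` {..<2 * n} = {..<2 * n}"
    proof
      show "zigzag n i ` {..<2 * n} \<subseteq> {..<2 * n}"
        using zigzag_less[OF assms(1)] by auto
      show "{..<2 * n} \<subseteq> zigzag n i ` {..<2 * n}"
        using zigzag_surj[OF that] by (metis image_eqI lessThan_iff subsetI)
    qed
    then have "(\<lambda>j. f (zigzag n i j)) ` {..<2 * n} = verts G"
      using surj by (metis image_image)
    then show ?thesis
      unfolding p_def using assms by (intro hamiltonian_path_map_upt) auto
  qed
  have index: "(u + v + 1) mod (2 * n) div 2 = i"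
    if e: "{f u, f v} \<in> path_edges (p i)" and uv: "u < 2 * n" "v < 2 * n" and "i < n" for u v i
  proof -
    obtain j where j: "Suc j < 2 * n" "{f u, f v} = {f (zigzag n i j), f (zigzag n i (Suc j))}"
      using e unfolding edges by blast
    then have "f ` {u, v} = f ` {zigzag n i j, zigzag n i (Suc j)}" by simp
    then have "{u, v} = {zigzag n i j, zigzag n i (Suc j)}"
      using uv zigzag_less[OF assms(1)]
      by (subst (asm) inj_on_image_eq_iff[OF inj]) auto
    then have "u + v = zigzag n i j + zigzag n i (Suc j)" by (auto simp: doubleton_eq_iff)
    then show ?thesis using zigzag_edge_index[OF \<open>i < n\<close> j(1)] by simp
  qed
  have disj: "disjnt (path_edges (p i)) (path_edges (p i'))"
    if "i < n" and "i' < n" and "i \<noteq> i'" for i i'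
  proof -
    have False if e: "e \<in> path_edges (p i)" "e \<in> path_edges (p i')" for e
    proof -
      obtain j where "e = {f (zigzag n i j), f (zigzag n i (Suc j))}"
        using e(1) unfolding edges by blast
      with e index[OF _ zigzag_less zigzag_less] assms(1) \<open>i < n\<close> \<open>i' < n\<close>
      have "i = i'" by metis
      with \<open>i \<noteq> i'\<close> show False ..
    qed
    then show ?thesis by (auto simp: disjnt_iff)
  qed
  have cover: "\<exists>i<n. e \<in> path_edges (p i)" if edge: "e \<in> undirected_edges G" for e
  proof -
    obtain x y where xy: "e = {x, y}" "x \<noteq> y" "x \<in> f ` {..<2 * n}" "y \<in> f ` {..<2 * n}"
      unfolding surj using edge ends by (auto simp: undirected_edges_def)
    from xy(3,4) obtain u v where "x = f u" "u < 2 * n" "y = f v" "v < 2 * n" by auto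
    with xy(1,2) have uv: "e = {f u, f v}" "u < 2 * n" "v < 2 * n" "u \<noteq> v" by auto
    define i where "i = (u + v + 1) mod (2 * n) div 2"
    have "(u + v + 1) mod (2 * n) < 2 * n" using assms(1) by simp
    then have "i < n" by (simp add: i_def)
    obtain j where j: "Suc j < 2 * n" "{zigzag n i j, zigzag n i (Suc j)} = {u, v}"
      using zigzag_covers_edge[OF uv(2-4) i_def] .
    \<comment> \<open>Passing through the image lets the equation of label pairs be used without
      deciding which label is which.\<close>
    have "e = f ` {u, v}" using uv(1) by simp
    also have "\<dots> = {f (zigzag n i j), f (zigzag n i (Suc j))}" by (simp flip: j(2))
    finally have "e \<in> path_edges (p i)" unfolding edges using j(1) by blast
    with \<open>i < n\<close> show ?thesis by blast
  qed
  have "inj_on p {..<n}"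
  proof (rule inj_onI)
    fix i i' assume "i \<in> {..<n}" "i' \<in> {..<n}" "p i = p i'"
    \<comment> \<open>The rotation by \<open>i\<close> starts at the vertex labelled \<open>i\<close>.\<close>
    moreover have "p k ! 0 = f k" if "k < n" for k
      using that by (simp add: p_def zigzag_0)
    ultimately have "f i = f i'" by (metis lessThan_iff)
    then show "i = i'"
      using inj_onD[OF inj] \<open>i \<in> {..<n}\<close> \<open>i' \<in> {..<n}\<close> by simp
  qed
  then have "card (p ` {..<n}) = n" by (simp add: card_image)
  moreover have "hamiltonian_path_decomposition (p ` {..<n}) G"
    unfolding hamiltonian_path_decomposition_def
  proof (intro conjI ballI)
    fix q assume "q \<in> p ` {..<n}"
    then show "hamiltonian_path q G" using ham by auto
  next
    show "pairwise (\<lambda>p q. disjnt (path_edges p) (path_edges q)) (p ` {..<n})"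
      using disj by (auto simp: pairwise_def)
  next
    fix e assume "e \<in> undirected_edges G"
    then obtain i where "i < n" "e \<in> path_edges (p i)" using cover by blast
    then show "\<exists>!q. q \<in> p ` {..<n} \<and> e \<in> path_edges q"
      using disj by (intro ex1I[of _ "p i"]) (auto simp: disjnt_iff)
  qed
  ultimately show ?thesis by blast
qed

end
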